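(* Let $\overline{\mathcal C'}$ be the arrangement of 10 lines described in the context, and let $\mathcal A'$ be any affine line arrangement equiconfigurational with $\overline{\mathcal C'}$. Label the points and the lines of $\mathcal A'$ by the same letters as the corresponding ones of $\overline{\mathcal C'}$. Let $l_i(x,y)$, $i=1,\dots,9$, be equations of the 9 lines of $\mathcal A'$ other than $\overline{HE}$, and let $l_{10}(x,y)$ be an equation of the line $\overline{HE}$ of $\mathcal A'$. Let $\mathbb F$ be the extension of $\mathbb Q$ by the real coordinates of the points of the arrangement $\mathcal A'$, and let $G$ be its Galois group. The group $G$ acts on the points of $\mathbb F^2$ by conjugating the coordinates and on the lines in $\mathbb F^2$ by conjugating the coefficients of their equations. Then the product $\varphi:=\prod_{i=1}^{10} l_i(x,y)$ is not $G$-invariant.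
   Context: Two arrangements of lines are called equiconfigurational if there is a bijection between their lines that preserves the incidence structure, i.e. a set of lines of the first arrangement has a common point if and only if the corresponding set of lines of the second has a common point (points being taken in the real projective plane, so that parallel affine lines meet at a point at infinity). The points of an arrangement are the intersection points of its lines. Construction of $\overline{\mathcal C'}$. Let $I=(0,0)$ and let $A,B,C,D$ be the following four vertices of the regular pentagon inscribed in the unit circle: $A=(\cos 126^\circ,\sin 126^\circ)$, $B=(\cos 54^\circ,\sin 54^\circ)$, $C=(\cos 342^\circ,\sin 342^\circ)$, $D=(\cos 198^\circ,\sin 198^\circ)$. Put $E=\overline{AB}\cap\overline{DI}$, $F=\overline{AB}\cap\overline{CI}$, $G_0=\overline{BI}\cap\overline{AD}$, $H=\overline{AI}\cap\overline{BC}$. The arrangement $\mathcal C'$ consists of the 9 lines $\overline{AB},\overline{BC},\overline{AD},\overline{AI},\overline{BI},\overline{CI},\overline{DI},\overline{EC},\overline{FD}$ (the line $\overline{EC}$ passes through $G_0$ and the line $\overline{FD}$ passes through $H$). The arrangement $\overline{\mathcal C'}$ is obtained from $\mathcal C'$ by adding the 10th line $\overline{HE}$; it consists of 10 lines intersecting at 18 points, including one point at infinity, the intersection of the parallel lines $\overline{AD}$ and $\overline{HE}$.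
   Formalization: If 𝔽 is not Galois over ℚ, its automorphism group can be trivial and the claim fails; so G is taken to be the Galois group of any field L containing 𝔽 and Galois over ℚ (fixed field ℚ), with L = 𝔽 allowed when 𝔽 is Galois. *)

theory Defs
  imports "HOL-Analysis.Analysis" "HOL-Computational_Algebra.Polynomial"
begin

section \<open>Arrangements of lines in the affine plane\<close>

type_synonym point = "real \<times> real"
type_synonym line = "point set"

definition is_line :: "line \<Rightarrow> bool" where
  "is_line l \<longleftrightarrow> affine l \<and> aff_dim l = 1"

definition line_arrangement :: "line set \<Rightarrow> bool" where
  "line_arrangement \<A> \<longleftrightarrow> finite \<A> \<and> (\<forall>l\<in>\<A>. is_line l)"

text \<open>
  Common points are taken in the real projective plane: the point is either an affine point
  lying on every line of the set, or a point at infinity, given by a nonzero vector \<open>d\<close>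
  which is a direction of every line of the set.
\<close>

definition have_common_point :: "line set \<Rightarrow> bool" where
  "have_common_point S \<longleftrightarrow>
     (\<exists>p. \<forall>l\<in>S. p \<in> l) \<or> (\<exists>d. d \<noteq> 0 \<and> (\<forall>l\<in>S. \<forall>p\<in>l. p + d \<in> l))"

definition equiconfigurational :: "line set \<Rightarrow> line set \<Rightarrow> bool" where
  "equiconfigurational \<A> \<B> \<longleftrightarrow>
     (\<exists>f. bij_betw f \<A> \<B> \<and>
          (\<forall>S\<subseteq>\<A>. have_common_point S \<longleftrightarrow> have_common_point (f ` S)))"

text \<open>The affine intersection points; points at infinity have no coordinates in the plane.\<close>

definition arrangement_points :: "line set \<Rightarrow> point set" where
  "arrangement_points \<A> = {p. \<exists>l\<in>\<A>. \<exists>m\<in>\<A>. l \<noteq> m \<and> p \<in> l \<and> p \<in> m}"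

definition line_through :: "point \<Rightarrow> point \<Rightarrow> line" where
  "line_through p q = affine hull {p, q}"

definition meet :: "line \<Rightarrow> line \<Rightarrow> point" where
  "meet l m = (THE p. p \<in> l \<and> p \<in> m)"


section \<open>The pentagon arrangement\<close>

definition circle_point :: "real \<Rightarrow> point" where
  "circle_point t = (cos (t * pi / 180), sin (t * pi / 180))"

definition ptI :: point where "ptI = (0, 0)"
definition ptA :: point where "ptA = circle_point 126"
definition ptB :: point where "ptB = circle_point 54"
definition ptC :: point where "ptC = circle_point 342"
definition ptD :: point where "ptD = circle_point 198"
definition ptE :: point where "ptE = meet (line_through ptA ptB) (line_through ptD ptI)"
definition ptF :: point where "ptF = meet (line_through ptA ptB) (line_through ptC ptI)"
definition ptH :: point where "ptH = meet (line_through ptA ptI) (line_through ptB ptC)"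

definition arrC' :: "line set" where
  "arrC' = {line_through ptA ptB, line_through ptB ptC, line_through ptA ptD,
            line_through ptA ptI, line_through ptB ptI, line_through ptC ptI,
            line_through ptD ptI, line_through ptE ptC, line_through ptF ptD}"

definition arrC'_bar :: "line set" where
  "arrC'_bar = insert (line_through ptH ptE) arrC'"


section \<open>Fields of coordinates and Galois groups\<close>

text \<open>
  All fields are represented as subsets of the complex numbers. Real coordinates are embedded
  by \<^const>\<open>complex_of_real\<close>. The ambient field is complex because the conjugates of a real
  number need not be real.
\<close>

definition is_subfield :: "complex set \<Rightarrow> bool" where
  "is_subfield K \<longleftrightarrow> 0 \<in> K \<and> 1 \<in> K \<and>
     (\<forall>x\<in>K. \<forall>y\<in>K. x + y \<in> K \<and> x * y \<in> K) \<and>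
     (\<forall>x\<in>K. - x \<in> K \<and> inverse x \<in> K)"

definition coordinate_field :: "line set \<Rightarrow> complex set" where
  "coordinate_field \<A> =
     is_subfield hull (\<Union>p\<in>arrangement_points \<A>. {complex_of_real (fst p), complex_of_real (snd p)})"

text \<open>
  The automorphisms of \<open>K\<close> over the rationals. They are functions on the whole type whose
  values outside \<open>K\<close> are irrelevant.
\<close>

definition galois_group :: "complex set \<Rightarrow> (complex \<Rightarrow> complex) set" where
  "galois_group K = {\<sigma>. bij_betw \<sigma> K K \<and>
     (\<forall>x\<in>K. \<forall>y\<in>K. \<sigma> (x + y) = \<sigma> x + \<sigma> y \<and> \<sigma> (x * y) = \<sigma> x * \<sigma> y) \<and>
     (\<forall>q\<in>\<rat>. \<sigma> q = q)}"

text \<open>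
  \<open>K\<close> is Galois over the rationals if the fixed field of its automorphism group is
  \<^term>\<open>\<rat> :: complex set\<close>. For algebraic \<open>K\<close> this means normal and separable; the
  definition also makes sense for transcendental \<open>K\<close>.

  The coordinate field of an arrangement need not be Galois over the rationals, and it can even have
  no nontrivial automorphism. The Galois group of a field \<open>F\<close> is therefore read as the group of a
  field \<open>L \<supseteq> F\<close> that is Galois over the rationals: \<open>L = F\<close> if \<open>F\<close> is itself Galois, and for
  instance the normal closure of \<open>F\<close> if \<open>F\<close> is merely algebraic.
\<close>

definition galois_over_Rats :: "complex set \<Rightarrow> bool" where
  "galois_over_Rats K \<longleftrightarrow>
     is_subfield K \<and> {x\<in>K. \<forall>\<sigma>\<in>galois_group K. \<sigma> x = x} = \<rat>"


section \<open>Equations of lines and the Galois action\<close>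

text \<open>
  A polynomial in \<open>x\<close> and \<open>y\<close> is a polynomial in \<open>y\<close> whose coefficients are polynomials
  in \<open>x\<close>, so the following is \<open>a x + b y + c\<close>.
\<close>

definition linear_poly :: "complex \<Rightarrow> complex \<Rightarrow> complex \<Rightarrow> complex poly poly" where
  "linear_poly a b c = [: [:c, a:], [:b:] :]"

definition is_equation_over :: "complex set \<Rightarrow> line \<Rightarrow> complex poly poly \<Rightarrow> bool" where
  "is_equation_over K m p \<longleftrightarrow>
     (\<exists>a\<in>K. \<exists>b\<in>K. \<exists>c\<in>K. p = linear_poly a b c \<and>
        m = {(x, y). a * complex_of_real x + b * complex_of_real y + c = 0})"

definition invariant_under ::
    "(complex \<Rightarrow> complex) set \<Rightarrow> complex poly poly \<Rightarrow> bool" where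
  "invariant_under G p \<longleftrightarrow> (\<forall>\<sigma>\<in>G. map_poly (map_poly \<sigma>) p = p)"

end

theory Submission
  imports Defs
begin

text \<open>
  A line with equation \<open>a x + b y + c = 0\<close> is represented by its coefficient vector \<open>(a, b, c)\<close>.
  Three lines have a common point in the projective plane if and only if the determinant of their
  vectors vanishes (lemma \<open>have_common_point_iff_det3\<close>). An arrangement equiconfigurational with the
  pentagon arrangement therefore gives ten vectors for which a prescribed list of
  determinants vanishes and all other determinants do not.

  These conditions leave almost no freedom. Let \<open>c\<close> be the cross ratio of the four lines through
  the centre \<open>I\<close>, read off on the line \<open>AB\<close>; it is a quotient of products of determinants. In a basis
  adapted to \<open>AI\<close>, \<open>BI\<close>, \<open>AB\<close> the incidences reduce to two equations between slopes, and
  eliminating gives \<open>c\<^sup>2 - 3 c + 1 = 0\<close> (lemma \<open>cross_ratio_equation\<close>). So \<open>c\<close> is irrational, in every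
  equiconfigurational arrangement.

  Suppose now that the product of the ten equations is invariant under an automorphism \<open>\<sigma>\<close>. Then
  \<open>\<sigma>\<close> carries each linear factor to a multiple of a linear factor
  (lemma \<open>linear_factor_proportional\<close>), so it induces a permutation of the ten lines. As \<open>\<sigma>\<close>
  respects the vanishing of determinants, the permutation is an automorphism of the incidence
  structure. The incidence structure has no automorphism but the identity
  (lemma \<open>concurrence_automorphism_trivial\<close>). Hence \<open>\<sigma>\<close> multiplies every coefficient vector by a
  scalar; the scalars cancel in \<open>c\<close>, and \<open>\<sigma>\<close> fixes \<open>c\<close>. If this happened for all \<open>\<sigma>\<close> in the group of
  a Galois field, \<open>c\<close> would be rational.
\<close>

section \<open>Lines, their coefficient vectors and common points\<close>

type_synonym 'a vec3 = "'a \<times> 'a \<times> 'a"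

fun det3 :: "'a::comm_ring_1 vec3 \<Rightarrow> 'a vec3 \<Rightarrow> 'a vec3 \<Rightarrow> 'a" where
  "det3 (a1, b1, c1) (a2, b2, c2) (a3, b3, c3) =
     a1 * (b2 * c3 - b3 * c2) - b1 * (a2 * c3 - a3 * c2) + c1 * (a2 * b3 - a3 * b2)"

definition line_of :: "real vec3 \<Rightarrow> line" where
  "line_of = (\<lambda>(a, b, c). {(x, y). a * x + b * y + c = 0})"

text \<open>
  The vectors that are coefficient vectors of an affine line; \<open>(0, 0, 1)\<close> would be the line at infinity.
\<close>

fun nondegenerate :: "'a::zero vec3 \<Rightarrow> bool" where
  "nondegenerate (a, b, c) \<longleftrightarrow> a \<noteq> 0 \<or> b \<noteq> 0"

lemma mem_line_of: "(x, y) \<in> line_of (a, b, c) \<longleftrightarrow> a * x + b * y + c = 0"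
  by (simp add: line_of_def)

lemma line_of_nonempty:
  assumes "nondegenerate v" shows "\<exists>p. p \<in> line_of v"
proof -
  obtain a b c where v: "v = (a, b, c)" by (cases v)
  show ?thesis
  proof (cases "b = 0")
    case True
    with assms v have "(- c / a, 0) \<in> line_of v" by (simp add: mem_line_of)
    then show ?thesis ..
  next
    case False
    with v have "(0, - c / b) \<in> line_of v" by (simp add: mem_line_of)
    then show ?thesis ..
  qed
qed

lemma line_of_direction_iff:
  assumes "nondegenerate (a, b, c)"
  shows "(\<forall>p\<in>line_of (a, b, c). p + (d, e) \<in> line_of (a, b, c)) \<longleftrightarrow> a * d + b * e = 0"
proof
  assume "\<forall>p\<in>line_of (a, b, c). p + (d, e) \<in> line_of (a, b, c)"
  moreover obtain p where "p \<in> line_of (a, b, c)"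
    using line_of_nonempty[OF assms] by blast
  ultimately have "(fst p, snd p) \<in> line_of (a, b, c)"
    and "(fst p + d, snd p + e) \<in> line_of (a, b, c)"
    by (cases p, force)+
  then show "a * d + b * e = 0"
    unfolding mem_line_of by (simp add: algebra_simps)
next
  assume "a * d + b * e = 0"
  then show "\<forall>p\<in>line_of (a, b, c). p + (d, e) \<in> line_of (a, b, c)"
    by (auto simp: mem_line_of algebra_simps)
qed

text \<open>
  A point \<open>(x, y)\<close> on three lines is the kernel vector \<open>(x, y, 1)\<close> of the matrix of their coefficients, and
  a common direction \<open>(d, e)\<close> is the kernel vector \<open>(d, e, 0)\<close>; this treats both kinds of common point at once.
\<close>

lemma det3_eq_0_if_kernel:
  fixes x y z :: "'a::idom"
  assumes "a1 * x + b1 * y + c1 * z = 0" "a2 * x + b2 * y + c2 * z = 0"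
    "a3 * x + b3 * y + c3 * z = 0" and "x \<noteq> 0 \<or> y \<noteq> 0 \<or> z \<noteq> 0"
  shows "det3 (a1, b1, c1) (a2, b2, c2) (a3, b3, c3) = 0"
proof -
  let ?d = "det3 (a1, b1, c1) (a2, b2, c2) (a3, b3, c3)"
  have "?d * x = 0" "?d * y = 0" "?d * z = 0"
    unfolding det3.simps using assms(1-3) by algebra+
  with assms(4) show ?thesis by auto
qed

text \<open>
  If the first two lines are not parallel, they meet in the point given by Cramer's rule, and the
  vanishing determinant puts this point on the third line.
\<close>

lemma affine_common_point:
  assumes "a1 * b2 - a2 * b1 \<noteq> 0" "det3 (a1, b1, c1) (a2, b2, c2) (a3, b3, c3) = 0"
  shows "have_common_point {line_of (a1, b1, c1), line_of (a2, b2, c2), line_of (a3, b3, c3)}"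
proof -
  define D where "D = a1 * b2 - a2 * b1"
  define x where "x = (b1 * c2 - b2 * c1) / D"
  define y where "y = (c1 * a2 - c2 * a1) / D"
  have xD: "x * D = b1 * c2 - b2 * c1" and yD: "y * D = c1 * a2 - c2 * a1"
    using assms(1) by (simp_all add: x_def y_def D_def)
  have D: "D \<noteq> 0" using assms(1) by (simp add: D_def)
  have "(a1 * x + b1 * y + c1) * D = 0" "(a2 * x + b2 * y + c2) * D = 0"
      "(a3 * x + b3 * y + c3) * D = 0"
    using xD yD assms(2) unfolding D_def det3.simps by algebra+
  with D have "(x, y) \<in> line_of (a1, b1, c1)" "(x, y) \<in> line_of (a2, b2, c2)" 
    "(x, y) \<in> line_of (a3, b3, c3)" unfolding mem_line_of by simp_all
  then show ?thesis unfolding have_common_point_def by blast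
qed

text \<open>
  The determinant sees only linear dependence of the coefficient vectors, so the equivalence covers
  affine points and points at infinity, and it also holds when some of the three lines coincide.
\<close>

lemma have_common_point_iff_det3:
  assumes "nondegenerate u" "nondegenerate v" "nondegenerate w"
  shows "have_common_point {line_of u, line_of v, line_of w} \<longleftrightarrow> det3 u v w = 0"
proof -
  obtain a1 b1 c1 a2 b2 c2 a3 b3 c3
    where u: "u = (a1, b1, c1)" and v: "v = (a2, b2, c2)" and w: "w = (a3, b3, c3)"
    by (metis prod_cases3)
  have dirs: "(\<forall>l\<in>{line_of u, line_of v, line_of w}. \<forall>p\<in>l. p + (d, e) \<in> l) \<longleftrightarrow>
      a1 * d + b1 * e = 0 \<and> a2 * d + b2 * e = 0 \<and> a3 * d + b3 * e = 0" for d e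
    using assms line_of_direction_iff unfolding u v w by auto
  show ?thesis
  proof
    assume "have_common_point {line_of u, line_of v, line_of w}"
    then consider (affine) x y where "\<forall>l\<in>{line_of u, line_of v, line_of w}. (x, y) \<in> l"
      | (infinite) d e where "(d, e) \<noteq> 0"
          "\<forall>l\<in>{line_of u, line_of v, line_of w}. \<forall>p\<in>l. p + (d, e) \<in> l"
      unfolding have_common_point_def by (metis surj_pair)
    then show "det3 u v w = 0"
    proof cases
      case affine
      then show ?thesis unfolding u v w
        by (intro det3_eq_0_if_kernel[of _ x _ y _ 1]) (auto simp: mem_line_of)
    next
      case infinite
      with dirs show ?thesis unfolding u v w
        by (intro det3_eq_0_if_kernel[of _ d _ e _ 0]) (auto simp: zero_prod_def)
    qed
  next
    assume det: "det3 u v w = 0"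
    then have perm: "det3 w u v = 0"
      unfolding u v w det3.simps by algebra
    \<comment> \<open>If the first line is parallel to both others, its direction is common to all three.\<close>
    consider (uv) "a1 * b2 - a2 * b1 \<noteq> 0" | (wu) "a3 * b1 - a1 * b3 \<noteq> 0"
      | (parallel) "a1 * b2 - a2 * b1 = 0" "a3 * b1 - a1 * b3 = 0"
      by blast
    then show "have_common_point {line_of u, line_of v, line_of w}"
    proof cases
      case parallel
      have "(- b1, a1) \<noteq> 0" using assms(1) by (auto simp: u zero_prod_def)
      moreover have "\<forall>l\<in>{line_of u, line_of v, line_of w}. \<forall>p\<in>l. p + (- b1, a1) \<in> l"
        unfolding dirs using parallel by (simp add: algebra_simps)
      ultimately show ?thesis unfolding have_common_point_def by blast
    next
      case uv
      then show ?thesis using affine_common_point det unfolding u v w by blast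
    next
      case wu
      then have "have_common_point {line_of w, line_of u, line_of v}"
        using affine_common_point perm unfolding u v w by blast
      then show ?thesis by (simp add: insert_commute)
    qed
  qed
qed

lemma line_through_eq_line_of:
  assumes "b \<noteq> 0" "(x1, y1) \<in> line_of (a, b, c)" "(x2, y2) \<in> line_of (a, b, c)" "x1 \<noteq> x2"
  shows "line_through (x1, y1) (x2, y2) = line_of (a, b, c)"
proof -
  have 1: "a * x1 + b * y1 + c = 0" "a * x2 + b * y2 + c = 0"
    using assms by (simp_all add: mem_line_of)
  have "p \<in> line_through (x1, y1) (x2, y2) \<longleftrightarrow> p \<in> line_of (a, b, c)" for p
  proof
    assume "p \<in> line_through (x1, y1) (x2, y2)"
    then obtain u v where p: "p = (u * x1 + v * x2, u * y1 + v * y2)" and "u + v = 1"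
      by (auto simp: line_through_def affine_hull_2)
    have "a * (u * x1 + v * x2) + b * (u * y1 + v * y2) + c = 0"
      using 1 \<open>u + v = 1\<close> by algebra
    then show "p \<in> line_of (a, b, c)" by (simp add: p mem_line_of)
  next
    obtain x y where p: "p = (x, y)" by (cases p)
    assume "p \<in> line_of (a, b, c)"
    then have xy: "a * x + b * y + c = 0" by (simp add: p mem_line_of)
    define v where "v = (x - x1) / (x2 - x1)"
    have v: "v * (x2 - x1) = x - x1" using assms(4) by (simp add: v_def)
    have "b * y = b * ((1 - v) * y1 + v * y2)"
      using 1 xy v by algebra
    then have "y = (1 - v) * y1 + v * y2" using assms(1) by simp
    moreover have "x = (1 - v) * x1 + v * x2" using v by (simp add: algebra_simps)
    ultimately have "p = (1 - v) *\<^sub>R (x1, y1) + v *\<^sub>R (x2, y2)" by (simp add: p)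
    then show "p \<in> line_through (x1, y1) (x2, y2)"
      unfolding line_through_def affine_hull_2 by (metis (mono_tags, lifting) diff_add_cancel mem_Collect_eq)
  qed
  then show ?thesis by blast
qed

lemma meet_line_of:
  assumes "b1 \<noteq> 0" "b2 \<noteq> 0" "a1 * b2 \<noteq> a2 * b1"
    and "p \<in> line_of (a1, b1, c1)" "p \<in> line_of (a2, b2, c2)"
  shows "meet (line_of (a1, b1, c1)) (line_of (a2, b2, c2)) = p"
  unfolding meet_def
proof (rule the_equality)
  show "p \<in> line_of (a1, b1, c1) \<and> p \<in> line_of (a2, b2, c2)" using assms by simp
  fix q assume "q \<in> line_of (a1, b1, c1) \<and> q \<in> line_of (a2, b2, c2)"
  moreover obtain x y x' y' where pq: "p = (x, y)" "q = (x', y')" by (metis surj_pair)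
  ultimately have "a1 * x' + b1 * y' + c1 = 0" "a2 * x' + b2 * y' + c2 = 0" 
     "a1 * x + b1 * y + c1 = 0" "a2 * x + b2 * y + c2 = 0" 
    using assms(4,5) by (simp_all add: mem_line_of)
  then have "(a1 * b2 - a2 * b1) * (x' - x) = 0" "(a1 * b2 - a2 * b1) * (y' - y) = 0"
    by algebra+
  then show "q = p" using assms(3) by (simp add: pq)
qed

section \<open>The incidences of the ten lines\<close>

datatype label = AB | BC | AD | AI | BI | CI | DI | EC | FD | HE

definition labels :: "label list" where
  "labels = [AB, BC, AD, AI, BI, CI, DI, EC, FD, HE]"

lemma set_labels: "set labels = UNIV"
  unfolding labels_def using label.exhaust by auto

instance label :: finite
  by standard (metis List.finite_set set_labels)

text \<open>
  The lines through each of \<open>A\<close>, \<open>B\<close>, \<open>C\<close>, \<open>D\<close>, \<open>F\<close>, \<open>G\<^sub>0\<close>, \<open>E\<close>, \<open>H\<close>, \<open>I\<close>. The remaining nine points of the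
  arrangement, among them the point at infinity of \<open>AD\<close> and \<open>HE\<close>, lie on two lines only.
\<close>

definition multiple_points :: "label list list" where
  "multiple_points =
     [[AB, AD, AI], [AB, BC, BI], [BC, CI, EC], [AD, DI, FD], [AB, CI, FD], [AD, BI, EC],
      [AB, DI, EC, HE], [BC, AI, FD, HE], [AI, BI, CI, DI]]"

text \<open>
  Triples with a repetition are included because two lines always meet in the projective plane.
  The relation then agrees with the vanishing of a determinant for all triples.
\<close>

definition concurrent :: "label \<Rightarrow> label \<Rightarrow> label \<Rightarrow> bool" where
  "concurrent i j k \<longleftrightarrow>
     i = j \<or> j = k \<or> i = k \<or> (\<exists>P\<in>set multiple_points. i \<in> set P \<and> j \<in> set P \<and> k \<in> set P)"

lemma concurrent_all_imp_eq:
  assumes "\<And>k. concurrent i j k"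
  shows "i = j"
proof -
  have "\<forall>i\<in>set labels. \<forall>j\<in>set labels. (\<forall>k\<in>set labels. concurrent i j k) \<longrightarrow> i = j"
    unfolding labels_def by code_simp
  then show ?thesis using assms unfolding set_labels by blast
qed

text \<open>
  This counts ordered pairs: a point on three lines contributes 2 to each of its lines, and a point
  on four lines contributes 6.
\<close>

definition concurrence_count :: "label \<Rightarrow> nat" where
  "concurrence_count i = card {(j, k). distinct [i, j, k] \<and> concurrent i j k}"

lemma concurrence_count_eq:
  "concurrence_count i =
     (if i = AD then 6 else if i \<in> {AB, HE} then 12 else if i \<in> {AI, DI} then 14 else 10)"
proof -
  have "{(j, k). distinct [i, j, k] \<and> concurrent i j k} = 
      set (filter (\<lambda>(j, k). distinct [i, j, k] \<and> concurrent i j k) (List.product labels labels))" 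
    (is "_ = set ?xs")
    by (auto simp: set_labels)
  moreover have "distinct ?xs"
    by (intro distinct_filter distinct_product) (simp_all add: labels_def)
  ultimately have "concurrence_count i = length ?xs"
    unfolding concurrence_count_def by (simp only: distinct_card)
  also have "\<forall>i\<in>set labels. length (filter (\<lambda>(j, k). distinct [i, j, k] \<and> concurrent i j k)
      (List.product labels labels)) =
      (if i = AD then 6 else if i \<in> {AB, HE} then 12 else if i \<in> {AI, DI} then 14 else 10)"
    unfolding labels_def by code_simp
  then have "length ?xs =
      (if i = AD then 6 else if i \<in> {AB, HE} then 12 else if i \<in> {AI, DI} then 14 else 10)"
    unfolding set_labels by blast
  finally show ?thesis .
qed

text \<open>
  The number of concurrent triples through a line is invariant; it singles out \<open>AD\<close> and the pairs
  \<open>AB\<close>, \<open>HE\<close> and \<open>AI\<close>, \<open>DI\<close>. The point \<open>A\<close> on \<open>AB\<close>, \<open>AD\<close>, \<open>AI\<close> separates the members of each pair. From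
  then on, each further line is the only one not yet known to be fixed that is concurrent with two
  suitable fixed lines.
\<close>

lemma concurrence_automorphism_trivial:
  assumes inj: "inj \<pi>" and conc: "\<And>i j k. concurrent (\<pi> i) (\<pi> j) (\<pi> k) \<longleftrightarrow> concurrent i j k"
  shows "\<pi> i = i"
proof -
  have bij: "bij \<pi>" using inj by (simp add: finite_UNIV_inj_surj bij_def)
  have inv: "concurrence_count (\<pi> i) = concurrence_count i" for i
  proof -
    have "bij_betw (map_prod \<pi> \<pi>) {(j, k). distinct [i, j, k] \<and> concurrent i j k}
        {(j, k). distinct [\<pi> i, j, k] \<and> concurrent (\<pi> i) j k}"
    proof (intro bij_betw_imageI)
      show "inj_on (map_prod \<pi> \<pi>) {(j, k). distinct [i, j, k] \<and> concurrent i j k}"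
        using inj by (auto simp: inj_on_def)
      show "map_prod \<pi> \<pi> ` {(j, k). distinct [i, j, k] \<and> concurrent i j k}
          = {(j, k). distinct [\<pi> i, j, k] \<and> concurrent (\<pi> i) j k}" (is "?f ` ?A = ?B")
      proof
        show "?f ` ?A \<subseteq> ?B" using conc inj by (auto simp: inj_eq)
        show "?B \<subseteq> ?f ` ?A"
        proof
          fix x assume x: "x \<in> ?B"
          obtain j k where "fst x = \<pi> j" "snd x = \<pi> k"
            using bij by (meson bij_pointE)
          then have jk: "x = (\<pi> j, \<pi> k)" by (simp add: prod_eq_iff)
          with x conc have "(j, k) \<in> ?A" by auto
          then show "x \<in> ?f ` ?A" by (force simp: jk)
        qed
      qed
    qed
    from bij_betw_same_card[OF this] show ?thesis unfolding concurrence_count_def by (rule sym)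
  qed
  \<comment> \<open>If two lines are already known to be fixed, a line concurrent with them stays concurrent with them
    and remains different from them.\<close>
  have third: "\<pi> x \<noteq> a \<and> \<pi> x \<noteq> b \<and> concurrent a b (\<pi> x)"
    if "\<pi> i = a" "\<pi> j = b" "concurrent i j x" "x \<noteq> i" "x \<noteq> j" for i j x a b
    unfolding that(1,2)[symmetric] using that(3-5) conc inj by (simp add: inj_eq)
  note concs = concurrent_def multiple_points_def
  have AD: "\<pi> AD = AD"
    using inv[of AD] by (simp add: concurrence_count_eq split: if_splits)
  have "\<pi> AB \<in> {AB, HE}" "\<pi> AI \<in> {AI, DI}" "concurrent (\<pi> AB) AD (\<pi> AI)"
    using inv[of AB] inv[of AI] conc[of AB AD AI] AD
    by (simp_all add: concurrence_count_eq concs split: if_splits)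
  then have AB: "\<pi> AB = AB" and AI: "\<pi> AI = AI"
    by (auto simp: concs)
  have "\<pi> HE \<noteq> \<pi> AB" "\<pi> DI \<noteq> \<pi> AI"
    using inj by (simp_all add: inj_eq)
  then have HE: "\<pi> HE = HE" and DI: "\<pi> DI = DI"
    using inv[of HE] inv[of DI] unfolding AB AI
    by (simp_all add: concurrence_count_eq split: if_splits)
  have FD: "\<pi> FD = FD"
    using third[OF AD DI, of FD] by (cases "\<pi> FD") (simp_all add: concs)
  have CI: "\<pi> CI = CI"
    using third[OF AB FD, of CI] by (cases "\<pi> CI") (simp_all add: concs)
  have EC: "\<pi> EC = EC"
    using third[OF AB DI, of EC] inv[of EC]
    by (cases "\<pi> EC") (simp_all add: concs concurrence_count_eq)
  have BI: "\<pi> BI = BI"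
    using third[OF AD EC, of BI] by (cases "\<pi> BI") (simp_all add: concs)
  have BC: "\<pi> BC = BC"
    using third[OF AB BI, of BC] by (cases "\<pi> BC") (simp_all add: concs)
  show ?thesis
    by (cases i) (simp_all add: AB BC AD AI BI CI DI EC FD HE)
qed

section \<open>The pentagon arrangement in golden-ratio coordinates\<close>

text \<open>
  A rational algebraic integer is an integer, and no integer satisfies \<open>n (n - 1) = 1\<close>.
\<close>

lemma golden_irrational:
  fixes x :: "'a::field_char_0"
  assumes "x\<^sup>2 = x + 1"
  shows "x \<notin> \<rat>"
proof
  assume "x \<in> \<rat>"
  moreover have "algebraic_int x"
  proof (rule algebraic_int.intros)
    show "lead_coeff [:-1, -1, 1 :: 'a:] = 1" by simp
    show "\<forall>i. coeff [:-1, -1, 1 :: 'a:] i \<in> \<int>" by (auto simp: coeff_pCons split: nat.split)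
    show "poly [:-1, -1, 1 :: 'a:] x = 0" using assms by (simp add: algebra_simps power2_eq_square)
  qed
  ultimately have "x \<in> \<int>" by (rule rational_algebraic_int_is_int[rotated])
  then obtain n where n: "x = of_int n" by (auto elim: Ints_cases)
  with assms have "(of_int (n\<^sup>2) :: 'a) = of_int (n + 1)" by simp
  then have "n\<^sup>2 = n + 1" by (simp only: of_int_eq_iff)
  then have "n * (n - 1) = 1" by (simp add: algebra_simps power2_eq_square)
  then show False by (auto simp: zmult_eq_1_iff)
qed

text \<open>
  The pair \<open>(p, q)\<close> stands for \<open>p + q \<tau>\<close> in the ring \<open>\<int>[\<tau>]\<close>, where \<open>\<tau>\<^sup>2 = \<tau> + 1\<close>. In suitable coordinates all
  ten lines have slopes and intercepts in this ring, so that all their incidences are decided by integer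
  arithmetic.
\<close>

definition golden_mult :: "int \<times> int \<Rightarrow> int \<times> int \<Rightarrow> int \<times> int" where
  "golden_mult = (\<lambda>(p, q) (r, s). (p * r + q * s, p * s + q * r + q * s))"

definition golden_sub :: "int \<times> int \<Rightarrow> int \<times> int \<Rightarrow> int \<times> int" where
  "golden_sub = (\<lambda>(p, q) (r, s). (p - r, q - s))"

text \<open>
  In the coordinates \<open>u = x / sin 36\<degree>\<close>, \<open>w = 2 y\<close> the pentagon has vertices \<open>(-1, \<tau>)\<close>, \<open>(1, \<tau>)\<close>,
  \<open>(\<tau>, 1 - \<tau>)\<close>, \<open>(-\<tau>, 1 - \<tau>)\<close> for \<open>A\<close>, \<open>B\<close>, \<open>C\<close>, \<open>D\<close>. No line is vertical, and each has an equation
  \<open>w = slope * u + intercept\<close>.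
\<close>

fun slope :: "label \<Rightarrow> int \<times> int" where
  "slope AB = (0, 0)" | "slope BC = (-2, -1)" | "slope AD = (2, 1)" | "slope AI = (0, -1)"
| "slope BI = (0, 1)" | "slope CI = (-2, 1)" | "slope DI = (2, -1)" | "slope EC = (-4, 3)"
| "slope FD = (4, -3)" | "slope HE = (2, 1)"

fun intercept :: "label \<Rightarrow> int \<times> int" where
  "intercept AB = (0, 1)" | "intercept BC = (2, 2)" | "intercept AD = (2, 2)"
| "intercept AI = (0, 0)" | "intercept BI = (0, 0)" | "intercept CI = (0, 0)"
| "intercept DI = (0, 0)" | "intercept EC = (-2, 0)" | "intercept FD = (-2, 0)"
| "intercept HE = (-4, -6)"

text \<open>
  The determinant of the three rows \<open>(slope, 1, intercept)\<close>, up to sign.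
\<close>

definition golden_det :: "label \<Rightarrow> label \<Rightarrow> label \<Rightarrow> int \<times> int" where
  "golden_det i j k = golden_sub
     (golden_mult (golden_sub (slope j) (slope i)) (golden_sub (intercept k) (intercept i)))
     (golden_mult (golden_sub (slope k) (slope i)) (golden_sub (intercept j) (intercept i)))"

lemma golden_det_eq_0_iff: "golden_det i j k = (0, 0) \<longleftrightarrow> concurrent i j k"
proof -
  have "\<forall>i\<in>set labels. \<forall>j\<in>set labels. \<forall>k\<in>set labels.
      golden_det i j k = (0, 0) \<longleftrightarrow> concurrent i j k"
    unfolding labels_def by code_simp
  then show ?thesis by (simp add: set_labels)
qed

definition golden_real :: "real \<Rightarrow> int \<times> int \<Rightarrow> real" where
  "golden_real \<tau> = (\<lambda>(p, q). of_int p + of_int q * \<tau>)"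

lemma golden_real_sub: "golden_real \<tau> (golden_sub x y) = golden_real \<tau> x - golden_real \<tau> y"
  by (cases x; cases y) (simp add: golden_real_def golden_sub_def algebra_simps)

lemma golden_real_mult:
  assumes "\<tau>\<^sup>2 = \<tau> + 1"
  shows "golden_real \<tau> (golden_mult x y) = golden_real \<tau> x * golden_real \<tau> y"
proof -
  obtain p q r s where xy: "x = (p, q)" "y = (r, s)" by (metis surj_pair)
  have "golden_real \<tau> x * golden_real \<tau> y
      = of_int (p * r) + of_int (p * s + q * r) * \<tau> + of_int (q * s) * \<tau>\<^sup>2"
    by (simp add: xy golden_real_def algebra_simps power2_eq_square)
  then show ?thesis
    unfolding assms by (simp add: xy golden_real_def golden_mult_def algebra_simps)
qed

text \<open>
  Since \<open>\<tau>\<close> is irrational, \<open>p + q \<tau>\<close> vanishes only if \<open>p\<close> and \<open>q\<close> do. This is what turns a computation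
  with pairs into a statement on real lines, in particular the statement that three lines are not concurrent.
\<close>

lemma golden_real_eq_0_iff:
  assumes "\<tau>\<^sup>2 = \<tau> + 1"
  shows "golden_real \<tau> x = 0 \<longleftrightarrow> x = (0, 0)"
proof
  obtain p q where x: "x = (p, q)" by (cases x)
  assume 0: "golden_real \<tau> x = 0"
  have "q = 0"
  proof (rule ccontr)
    assume "q \<noteq> 0"
    with 0 have "\<tau> = - (of_int p / of_int q)" by (simp add: x golden_real_def field_simps)
    then have "\<tau> \<in> \<rat>" by simp
    with golden_irrational[OF assms] show False by simp
  qed
  with 0 show "x = (0, 0)" by (simp add: x golden_real_def)
qed (simp add: golden_real_def)

definition golden_ratio :: real where
  "golden_ratio = 2 * cos (pi / 5)"

text \<open>
  The regular pentagon inscribed in the unit circle has side \<open>2 sin 36\<degree>\<close>.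
\<close>

definition half_side :: real where
  "half_side = sin (pi / 5)"

lemma half_side_pos: "half_side > 0"
  unfolding half_side_def by (intro sin_gt_zero) simp_all

lemma golden_ratio_pos: "golden_ratio > 0"
  unfolding golden_ratio_def by (simp add: cos_gt_zero)

lemma golden_ratio_square: "golden_ratio\<^sup>2 = golden_ratio + 1"
proof -
  define c where "c = cos (pi / 5)"
  \<comment> \<open>The equation for the cosine comes from \<open>cos 3x = - cos 2x\<close> for \<open>x = pi / 5\<close>, where \<open>3x\<close> and \<open>2x\<close> add up to \<open>pi\<close>.\<close>
  have "cos (3 * (pi / 5)) = cos (pi - 2 * (pi / 5))" by (simp add: field_simps)
  then have "cos (3 * (pi / 5)) = - cos (2 * (pi / 5))" by (simp only: cos_pi_minus)
  then have "4 * c ^ 3 - 3 * c = - (2 * c\<^sup>2 - 1)"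
    unfolding c_def cos_treble_cos cos_double_cos by simp
  then have "(c + 1) * (4 * c\<^sup>2 - 2 * c - 1) = 0" by algebra
  moreover have "c + 1 \<noteq> 0" using golden_ratio_pos by (simp add: golden_ratio_def c_def)
  ultimately show ?thesis by (simp add: golden_ratio_def c_def power2_eq_square)
qed

lemma pentagon_vertices:
  defines "\<tau> \<equiv> golden_ratio" and "s \<equiv> half_side"
  shows "ptA = (- s, \<tau> / 2)" "ptB = (s, \<tau> / 2)"
    "ptC = (s * \<tau>, (1 - \<tau>) / 2)" "ptD = (- (s * \<tau>), (1 - \<tau>) / 2)"
proof -
  have dbl: "sin (2 * (pi / 5)) = s * \<tau>" "- cos (2 * (pi / 5)) = (1 - \<tau>) / 2"
    using golden_ratio_square unfolding sin_double cos_double_cos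
    by (simp_all add: \<tau>_def s_def half_side_def golden_ratio_def power2_eq_square)
  have one: "sin (pi / 5) = s" "cos (pi / 5) = \<tau> / 2"
    by (simp_all add: s_def \<tau>_def half_side_def golden_ratio_def)
  have three_halves: "cos (3 / 2 * pi) = 0" "sin (3 / 2 * pi) = - 1"
    using cos_3over2_pi sin_3over2_pi by simp_all
  have trig: "cos (pi / 2 + x) = - sin x" "sin (pi / 2 + x) = cos x"
      "cos (pi / 2 - x) = sin x" "sin (pi / 2 - x) = cos x"
      "cos (3 / 2 * pi + x) = sin x" "sin (3 / 2 * pi + x) = - cos x"
      "cos (3 / 2 * pi - x) = - sin x" "sin (3 / 2 * pi - x) = - cos x" for x :: real
    unfolding cos_add sin_add cos_diff sin_diff three_halves by simp_all
  \<comment> \<open>The angles are 90 + 36, 90 - 36, 270 + 72 and 270 - 72 degrees.\<close>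
  have "ptA = (cos (pi / 2 + pi / 5), sin (pi / 2 + pi / 5))"
      "ptB = (cos (pi / 2 - pi / 5), sin (pi / 2 - pi / 5))"
      "ptC = (cos (3 / 2 * pi + 2 * (pi / 5)), sin (3 / 2 * pi + 2 * (pi / 5)))"
      "ptD = (cos (3 / 2 * pi - 2 * (pi / 5)), sin (3 / 2 * pi - 2 * (pi / 5)))"
    unfolding circle_point_def ptA_def ptB_def ptC_def ptD_def by (simp_all add: field_simps)
  then show "ptA = (- s, \<tau> / 2)" "ptB = (s, \<tau> / 2)"
    "ptC = (s * \<tau>, (1 - \<tau>) / 2)" "ptD = (- (s * \<tau>), (1 - \<tau>) / 2)"
    unfolding trig dbl one by simp_all
qed

text \<open>
  The equation \<open>w = slope * u + intercept\<close> in terms of \<open>x\<close> and \<open>y\<close>, multiplied by \<open>half_side\<close>.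
\<close>

definition pent_coeffs :: "label \<Rightarrow> real vec3" where
  "pent_coeffs i = (golden_real golden_ratio (slope i), - 2 * half_side,
     half_side * golden_real golden_ratio (intercept i))"

lemma nondegenerate_pent_coeffs: "nondegenerate (pent_coeffs i)"
  using half_side_pos by (simp add: pent_coeffs_def)

lemma det3_pent_coeffs:
  "det3 (pent_coeffs i) (pent_coeffs j) (pent_coeffs k) = 0 \<longleftrightarrow> concurrent i j k"
proof -
  let ?g = "golden_real golden_ratio"
  have "det3 (pent_coeffs i) (pent_coeffs j) (pent_coeffs k)
      = 2 * half_side\<^sup>2 *
        ((?g (slope j) - ?g (slope i)) * (?g (intercept k) - ?g (intercept i))
       - (?g (slope k) - ?g (slope i)) * (?g (intercept j) - ?g (intercept i)))"
    unfolding pent_coeffs_def det3.simps by algebra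
  also have "\<dots> = 2 * half_side\<^sup>2 * ?g (golden_det i j k)"
    by (simp add: golden_det_def golden_real_sub golden_real_mult[OF golden_ratio_square])
  finally show ?thesis
    using half_side_pos golden_real_eq_0_iff[OF golden_ratio_square] golden_det_eq_0_iff by simp
qed

definition on_pent_line :: "label \<Rightarrow> real \<Rightarrow> real \<Rightarrow> bool" where
  "on_pent_line i u w \<longleftrightarrow>
     w = golden_real golden_ratio (slope i) * u + golden_real golden_ratio (intercept i)"

lemma mem_pent_line: "(half_side * u, w / 2) \<in> line_of (pent_coeffs i) \<longleftrightarrow> on_pent_line i u w"
proof -
  have "golden_real golden_ratio (slope i) * (half_side * u) + - 2 * half_side * (w / 2)
     + half_side * golden_real golden_ratio (intercept i) = half_side *
      (golden_real golden_ratio (slope i) * u + golden_real golden_ratio (intercept i) - w)"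
    by (simp add: algebra_simps)
  then show ?thesis
    unfolding pent_coeffs_def mem_line_of on_pent_line_def using half_side_pos by auto
qed

lemma line_through_eq_pent_line:
  assumes "on_pent_line i u1 w1" "on_pent_line i u2 w2" "u1 \<noteq> u2"
  shows "line_through (half_side * u1, w1 / 2) (half_side * u2, w2 / 2) = line_of (pent_coeffs i)"
  using assms half_side_pos unfolding mem_pent_line[symmetric] pent_coeffs_def
  by (intro line_through_eq_line_of) auto

lemma meet_pent_lines:
  assumes "slope i \<noteq> slope j" "on_pent_line i u w" "on_pent_line j u w"
  shows "meet (line_of (pent_coeffs i)) (line_of (pent_coeffs j)) = (half_side * u, w / 2)"
proof -
  have "golden_real golden_ratio (golden_sub (slope i) (slope j)) \<noteq> 0"
    using assms(1) unfolding golden_real_eq_0_iff[OF golden_ratio_square]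
    by (auto simp: golden_sub_def split: prod.splits)
  then show ?thesis
    using assms(2,3) half_side_pos
    unfolding mem_pent_line[symmetric] pent_coeffs_def golden_real_sub
    by (intro meet_line_of) auto
qed

text \<open>
  All points are exhibited explicitly in the coordinates \<open>u\<close>, \<open>w\<close>; besides the vertices these are
  \<open>E = (\<tau>\<^sup>3, \<tau>)\<close>, \<open>F = (-\<tau>\<^sup>3, \<tau>)\<close> and \<open>H = (\<tau>\<^sup>2, -\<tau>\<^sup>3)\<close>, with \<open>\<tau>\<^sup>2 = \<tau> + 1\<close> and \<open>\<tau>\<^sup>3 = 2 \<tau> + 1\<close>.
\<close>

lemma arrC'_bar_eq: "arrC'_bar = range (\<lambda>i. line_of (pent_coeffs i))"
proof -
  define \<tau> where "\<tau> = golden_ratio"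
  have sq: "\<tau>\<^sup>2 = \<tau> + 1" using golden_ratio_square by (simp add: \<tau>_def)
  have ne: "\<tau> \<noteq> 0" "1 \<noteq> \<tau>" "\<tau> \<noteq> - 1" "- 1 \<noteq> \<tau>" "2 * \<tau> + 1 \<noteq> \<tau>" "\<tau> + 1 \<noteq> 2 * \<tau> + 1"
    "- (2 * \<tau> + 1) \<noteq> - \<tau>"
    using sq golden_ratio_pos by (auto simp: \<tau>_def[symmetric])
  have pts: "ptI = (half_side * 0, 0 / 2)" "ptA = (half_side * (-1), \<tau> / 2)"
    "ptB = (half_side * 1, \<tau> / 2)" "ptC = (half_side * \<tau>, (1 - \<tau>) / 2)"
    "ptD = (half_side * (- \<tau>), (1 - \<tau>) / 2)"
    using pentagon_vertices by (simp_all add: ptI_def \<tau>_def)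
  note on = on_pent_line_def golden_real_def \<tau>_def[symmetric]
  have lines: "line_through ptA ptB = line_of (pent_coeffs AB)"
    "line_through ptB ptC = line_of (pent_coeffs BC)"
    "line_through ptA ptD = line_of (pent_coeffs AD)"
    "line_through ptA ptI = line_of (pent_coeffs AI)"
    "line_through ptB ptI = line_of (pent_coeffs BI)"
    "line_through ptC ptI = line_of (pent_coeffs CI)"
    "line_through ptD ptI = line_of (pent_coeffs DI)"
    unfolding pts
    by (rule line_through_eq_pent_line; simp add: on ne; use sq in algebra)+
  have ptE: "ptE = (half_side * (2 * \<tau> + 1), \<tau> / 2)"
    unfolding ptE_def lines by (rule meet_pent_lines; simp add: on; use sq in algebra)
  have ptF: "ptF = (half_side * (- (2 * \<tau> + 1)), \<tau> / 2)"
    unfolding ptF_def lines by (rule meet_pent_lines; simp add: on; use sq in algebra)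
  have ptH: "ptH = (half_side * (\<tau> + 1), (- (2 * \<tau> + 1)) / 2)"
    unfolding ptH_def lines by (rule meet_pent_lines; simp add: on; use sq in algebra)
  have "line_through ptE ptC = line_of (pent_coeffs EC)"
    "line_through ptF ptD = line_of (pent_coeffs FD)"
    "line_through ptH ptE = line_of (pent_coeffs HE)"
    unfolding ptE ptF ptH pts
    by (rule line_through_eq_pent_line; simp add: on ne; use sq in algebra)+
  then show ?thesis
    unfolding arrC'_bar_def arrC'_def lines set_labels[symmetric] labels_def by auto
qed

text \<open>
  Two equal lines would be concurrent with every third line, which holds for no two different labels.
\<close>

lemma inj_pent_lines: "inj (\<lambda>i. line_of (pent_coeffs i))"
proof (rule injI)
  fix i j assume eq: "line_of (pent_coeffs i) = line_of (pent_coeffs j)"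
  have iff: "have_common_point {line_of (pent_coeffs i), line_of (pent_coeffs j), line_of (pent_coeffs k)}
      \<longleftrightarrow> concurrent i j k" for i j k
    by (simp add: have_common_point_iff_det3 nondegenerate_pent_coeffs det3_pent_coeffs)
  have "concurrent i j k" for k
    using iff[of i j k] iff[of j j k] eq by (simp add: concurrent_def[of j j])
  then show "i = j" by (rule concurrent_all_imp_eq)
qed

section \<open>The cross ratio of the four lines through the centre\<close>

text \<open>
  The coordinates of \<open>v\<close> in the basis \<open>p\<close>, \<open>q\<close>, \<open>r\<close> by Cramer's rule, multiplied by \<open>det3 p q r\<close> to avoid
  division.
\<close>

fun coords3 :: "'a::comm_ring_1 vec3 \<Rightarrow> 'a vec3 \<Rightarrow> 'a vec3 \<Rightarrow> 'a vec3 \<Rightarrow> 'a vec3" where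
  "coords3 p q r v = (det3 v q r, det3 p v r, det3 p q v)"

lemma det3_coords3:
  fixes p :: "'a::idom vec3"
  shows "det3 (coords3 p q r u) (coords3 p q r v) (coords3 p q r w) = (det3 p q r)\<^sup>2 * det3 u v w"
proof -
  obtain p1 p2 p3 q1 q2 q3 r1 r2 r3 u1 u2 u3 v1 v2 v3 w1 w2 w3 where
    eqs: "p = (p1, p2, p3)" "q = (q1, q2, q3)" "r = (r1, r2, r3)"
    "u = (u1, u2, u3)" "v = (v1, v2, v3)" "w = (w1, w2, w3)"
    by (metis prod_cases3)
  show ?thesis unfolding eqs coords3.simps det3.simps by algebra
qed

text \<open>
  The cross ratio of the points in which \<open>AI\<close>, \<open>BI\<close>, \<open>CI\<close>, \<open>DI\<close> meet \<open>AB\<close>. Each vector occurs equally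
  often in the numerator and in the denominator, so rescaling the vectors changes nothing.
\<close>

definition cross_ratio :: "(label \<Rightarrow> 'a::field vec3) \<Rightarrow> 'a" where
  "cross_ratio v =
     (det3 (v AB) (v AI) (v CI) * det3 (v AB) (v BI) (v DI)) /
     (det3 (v AB) (v BI) (v CI) * det3 (v AB) (v AI) (v DI))"

text \<open>
  Up to scaling, the basis gives \<open>CI = (1, s, 0)\<close>, \<open>DI = (1, t, 0)\<close>, \<open>AD = (1, 0, m)\<close>, \<open>BC = (0, 1, n)\<close>.
  The lines \<open>EC\<close> and \<open>FD\<close> are then forced to be \<open>(1, t, m)\<close> and \<open>(1, s, n s)\<close>, and the points \<open>C\<close> and \<open>D\<close> give
  \<open>m = n (t - s)\<close> and \<open>t s = (t - s)\<^sup>2\<close>. The cross ratio is \<open>s / t\<close>.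
\<close>

lemma cross_ratio_normal_form:
  fixes w :: "label \<Rightarrow> 'a::field vec3"
  assumes conc: "\<And>i j k. det3 (w i) (w j) (w k) = 0 \<longleftrightarrow> concurrent i j k"
    and base: "w AI = (D, 0, 0)" "w BI = (0, D, 0)" "w AB = (0, 0, D)"
  shows "(cross_ratio w)\<^sup>2 - 3 * cross_ratio w + 1 = 0"
proof -
  note concs = concurrent_def multiple_points_def
  obtain x2 y2 z2 x3 y3 z3 x6 y6 z6 x7 y7 z7 x8 y8 z8 x9 y9 z9 where
    v: "w BC = (x2, y2, z2)" "w AD = (x3, y3, z3)" "w CI = (x6, y6, z6)"
       "w DI = (x7, y7, z7)" "w EC = (x8, y8, z8)" "w FD = (x9, y9, z9)"
    by (metis prod_cases3)
  have D: "D \<noteq> 0" using conc[of AI BI AB] by (simp add: base concs)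
  have 0: "x2 = 0" "y3 = 0" "z6 = 0" "z7 = 0"
    using conc[of AB BC BI] conc[of AB AD AI] conc[of AI BI CI] conc[of AI BI DI] D
    by (simp_all add: base v concs)
  have nz: "z2 \<noteq> 0" "y2 \<noteq> 0" "x3 \<noteq> 0" "z3 \<noteq> 0" "x6 \<noteq> 0" "y6 \<noteq> 0" "x7 \<noteq> 0" "y7 \<noteq> 0" "x8 \<noteq> 0" "x9 \<noteq> 0"
    using conc[of AI BI BC] conc[of AI AB BC] conc[of AB BI AD] conc[of AI BI AD]
      conc[of AB BI CI] conc[of AB AI CI] conc[of AB BI DI] conc[of AB AI DI]
      conc[of AB BI EC] conc[of AB BI FD] D
    by (simp_all add: base v concs)
  define s t m n where stmn: "s = y6 / x6" "t = y7 / x7" "m = z3 / x3" "n = z2 / y2"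
  have 1: "y6 = s * x6" "y7 = t * x7" "z3 = m * x3" "z2 = n * y2"
    using nz by (simp_all add: stmn)
  have 2: "y8 = t * x8" "z8 = m * x8" "y9 = s * x9" 
    using conc[of AB DI EC] conc[of AD BI EC] conc[of AB CI FD] D nz
    by (simp_all add: base v concs 0 1 algebra_simps)
  have 3: "z9 = n * s * x9"
    using conc[of BC AI FD] D nz by (simp add: base v concs 0 1 2 algebra_simps)
  have "x6 * x8 * y2 * (n * (t - s) - m) = 0"
    using conc[of BC CI EC] by (simp add: base v concs 0 1 2 algebra_simps)
  then have m: "m = n * (t - s)" using nz by simp
  have "x3 * x7 * x9 * n * (t * s - (t - s)\<^sup>2) = 0"
    using conc[of AD DI FD] by (simp add: base v concs 0 1 2 3 m algebra_simps power2_eq_square)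
  then have st: "t * s = (t - s)\<^sup>2" using nz 1 by auto
  have t: "t \<noteq> 0" using 1 nz by auto
  have "cross_ratio w = s / t"
    using D nz by (simp add: cross_ratio_def base v 0 1)
  then have s: "t * cross_ratio w = s" using t by simp
  have "t\<^sup>2 * ((cross_ratio w)\<^sup>2 - 3 * cross_ratio w + 1)
      = (t - t * cross_ratio w)\<^sup>2 - t * (t * cross_ratio w)"
    by (simp add: algebra_simps power2_eq_square)
  also have "\<dots> = 0" unfolding s st by simp
  finally have "t\<^sup>2 * ((cross_ratio w)\<^sup>2 - 3 * cross_ratio w + 1) = 0" .
  then show ?thesis using t by simp
qed

lemma cross_ratio_equation:
  fixes v :: "label \<Rightarrow> 'a::field vec3"
  assumes conc: "\<And>i j k. det3 (v i) (v j) (v k) = 0 \<longleftrightarrow> concurrent i j k"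
  shows "(cross_ratio v)\<^sup>2 - 3 * cross_ratio v + 1 = 0"
proof -
  define w where "w = (\<lambda>i. coords3 (v AI) (v BI) (v AB) (v i))"
  define D where "D = det3 (v AI) (v BI) (v AB)"
  have D: "D \<noteq> 0" unfolding D_def conc by (simp add: concurrent_def multiple_points_def)
  have det: "det3 (w i) (w j) (w k) = D\<^sup>2 * det3 (v i) (v j) (v k)" for i j k
    unfolding w_def D_def by (rule det3_coords3)
  have deg: "det3 (v i) (v i) (v j) = 0" "det3 (v i) (v j) (v i) = 0" "det3 (v j) (v i) (v i) = 0" for i j
    unfolding conc by (simp_all add: concurrent_def)
  have "cross_ratio v = cross_ratio w" using D by (simp add: cross_ratio_def det)
  also have "(cross_ratio w)\<^sup>2 - 3 * cross_ratio w + 1 = 0"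
  proof (rule cross_ratio_normal_form)
    show "det3 (w i) (w j) (w k) = 0 \<longleftrightarrow> concurrent i j k" for i j k
      using D conc by (simp add: det)
    show "w AI = (D, 0, 0)" "w BI = (0, D, 0)" "w AB = (0, 0, D)"
      by (simp_all add: w_def D_def deg)
  qed
  finally show ?thesis .
qed

text \<open>
  If \<open>c\<^sup>2 - 3 c + 1 = 0\<close>, then \<open>2 - c\<close> satisfies the equation of the golden ratio.
\<close>

lemma cross_ratio_irrational:
  fixes v :: "label \<Rightarrow> 'a::field_char_0 vec3"
  assumes "\<And>i j k. det3 (v i) (v j) (v k) = 0 \<longleftrightarrow> concurrent i j k"
  shows "cross_ratio v \<notin> \<rat>"
proof
  assume "cross_ratio v \<in> \<rat>"
  then have "2 - cross_ratio v \<in> \<rat>" by simp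
  moreover have "(2 - cross_ratio v)\<^sup>2 = (2 - cross_ratio v) + 1"
    using cross_ratio_equation[OF assms] by algebra
  ultimately show False using golden_irrational by blast
qed

section \<open>Ring homomorphisms defined on a subset\<close>

text \<open>
  A field automorphism of \<open>L\<close> has arbitrary values outside \<open>L\<close>, so that only its restriction is a ring
  homomorphism. Closure of \<open>S\<close> under differences yields zero, negatives and sums.
\<close>

definition ring_hom_on :: "'a::comm_ring_1 set \<Rightarrow> ('a \<Rightarrow> 'b::comm_ring_1) \<Rightarrow> bool" where
  "ring_hom_on S f \<longleftrightarrow> 1 \<in> S \<and> f 1 = 1 \<and>
     (\<forall>x\<in>S. \<forall>y\<in>S. x - y \<in> S \<and> f (x - y) = f x - f y \<and> x * y \<in> S \<and> f (x * y) = f x * f y)"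

lemma ring_hom_on_one:
  assumes "ring_hom_on S f" shows "1 \<in> S" "f 1 = 1"
  using assms by (simp_all add: ring_hom_on_def)

lemma ring_hom_on_diff:
  assumes "ring_hom_on S f" "x \<in> S" "y \<in> S" shows "x - y \<in> S" "f (x - y) = f x - f y"
  using assms by (simp_all add: ring_hom_on_def)

lemma ring_hom_on_mult:
  assumes "ring_hom_on S f" "x \<in> S" "y \<in> S" shows "x * y \<in> S" "f (x * y) = f x * f y"
  using assms by (simp_all add: ring_hom_on_def)

lemma ring_hom_on_zero:
  assumes "ring_hom_on S f" shows "0 \<in> S" "f 0 = 0"
  using ring_hom_on_diff[OF assms ring_hom_on_one(1)[OF assms] ring_hom_on_one(1)[OF assms]]
  by simp_all

lemma ring_hom_on_add:
  assumes "ring_hom_on S f" "x \<in> S" "y \<in> S" shows "x + y \<in> S" "f (x + y) = f x + f y"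
proof -
  note ring_hom_on_zero[OF assms(1)]
  with ring_hom_on_diff[OF assms(1), of 0 y] assms(3) have "- y \<in> S" "f (- y) = - f y" by simp_all
  with ring_hom_on_diff[OF assms(1,2), of "- y"] show "x + y \<in> S" "f (x + y) = f x + f y"
    by simp_all
qed

lemma ring_hom_on_sum:
  assumes "ring_hom_on S f" "\<And>i. i \<in> I \<Longrightarrow> g i \<in> S"
  shows "sum g I \<in> S" "f (sum g I) = (\<Sum>i\<in>I. f (g i))"
proof -
  have "sum g I \<in> S \<and> f (sum g I) = (\<Sum>i\<in>I. f (g i))"
    using assms(2)
    by (induction I rule: infinite_finite_induct)
       (simp_all add: ring_hom_on_zero[OF assms(1)] ring_hom_on_add[OF assms(1)])
  then show "sum g I \<in> S" "f (sum g I) = (\<Sum>i\<in>I. f (g i))" by simp_all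
qed

lemma ring_hom_on_prod:
  assumes "ring_hom_on S f" "\<And>i. i \<in> I \<Longrightarrow> g i \<in> S"
  shows "f (prod g I) = (\<Prod>i\<in>I. f (g i))"
proof -
  have "prod g I \<in> S \<and> f (prod g I) = (\<Prod>i\<in>I. f (g i))"
    using assms(2)
    by (induction I rule: infinite_finite_induct)
       (simp_all add: ring_hom_on_one[OF assms(1)] ring_hom_on_mult[OF assms(1)])
  then show ?thesis by simp
qed

text \<open>
  The statement can be iterated: applied twice, it shows that the action on polynomials in two
  variables with coefficients in \<open>S\<close> is multiplicative.
\<close>

lemma ring_hom_on_map_poly:
  assumes "ring_hom_on S f"
  shows "ring_hom_on {p. \<forall>n. coeff p n \<in> S} (map_poly f)"
proof -
  note hom = ring_hom_on_zero[OF assms] ring_hom_on_one[OF assms] ring_hom_on_diff[OF assms]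
    ring_hom_on_mult[OF assms] ring_hom_on_sum[OF assms]
  show ?thesis
    unfolding ring_hom_on_def
    by (auto simp: hom poly_eq_iff coeff_map_poly coeff_mult coeff_1)
qed

fun map_vec3 :: "('a \<Rightarrow> 'b) \<Rightarrow> 'a vec3 \<Rightarrow> 'b vec3" where
  "map_vec3 f (a, b, c) = (f a, f b, f c)"

fun vec_in :: "'a set \<Rightarrow> 'a vec3 \<Rightarrow> bool" where
  "vec_in S (a, b, c) \<longleftrightarrow> a \<in> S \<and> b \<in> S \<and> c \<in> S"

abbreviation scale :: "'a::comm_ring_1 \<Rightarrow> 'a vec3 \<Rightarrow> 'a vec3" where
  "scale r \<equiv> map_vec3 ((*) r)"

lemma det3_scale:
  "det3 (scale r u) (scale s v) (scale t w) = r * s * t * det3 u v w"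
  by (cases u; cases v; cases w) (simp add: algebra_simps)

lemma ring_hom_on_det3:
  assumes "ring_hom_on S f" "vec_in S u" "vec_in S v" "vec_in S w"
  shows "det3 u v w \<in> S" "det3 (map_vec3 f u) (map_vec3 f v) (map_vec3 f w) = f (det3 u v w)"
  using assms(2-4)
  by (cases u; cases v; cases w;
      simp add: ring_hom_on_add[OF assms(1)] ring_hom_on_diff[OF assms(1)]
        ring_hom_on_mult[OF assms(1)])+

lemma galois_group_ring_hom_on:
  assumes "is_subfield K" "\<sigma> \<in> galois_group K"
  shows "ring_hom_on K \<sigma>"
proof -
  have add: "\<sigma> (x + y) = \<sigma> x + \<sigma> y" and mul: "\<sigma> (x * y) = \<sigma> x * \<sigma> y" if "x \<in> K" "y \<in> K" for x y
    using assms(2) that by (auto simp: galois_group_def)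
  have K: "x - y \<in> K" if "x \<in> K" "y \<in> K" for x y
    using assms(1) that unfolding is_subfield_def by (metis add_uminus_conv_diff)
  have "\<sigma> (x - y) = \<sigma> x - \<sigma> y" if "x \<in> K" "y \<in> K" for x y
    using add[OF K[OF that] that(2)] by (simp add: algebra_simps)
  moreover have "\<sigma> 1 = 1" using assms(2) by (auto simp: galois_group_def)
  ultimately show ?thesis
    using assms(1) mul K by (auto simp: ring_hom_on_def is_subfield_def)
qed

lemma galois_group_eq_0_iff:
  assumes "is_subfield K" "\<sigma> \<in> galois_group K" "x \<in> K"
  shows "\<sigma> x = 0 \<longleftrightarrow> x = 0"
proof -
  have "0 \<in> K" "\<sigma> 0 = 0"
    using ring_hom_on_zero[OF galois_group_ring_hom_on[OF assms(1,2)]] by simp_all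
  moreover have "inj_on \<sigma> K" using assms(2) by (simp add: galois_group_def bij_betw_def)
  ultimately show ?thesis using assms(3) by (metis inj_onD)
qed

lemma galois_group_divide:
  assumes "is_subfield K" "\<sigma> \<in> galois_group K" "x \<in> K" "y \<in> K" "y \<noteq> 0"
  shows "x / y \<in> K" "\<sigma> (x / y) = \<sigma> x / \<sigma> y"
proof -
  show xy: "x / y \<in> K" using assms unfolding is_subfield_def divide_inverse by blast
  have "\<sigma> (x / y * y) = \<sigma> (x / y) * \<sigma> y"
    using ring_hom_on_mult[OF galois_group_ring_hom_on[OF assms(1,2)] xy assms(4)] by simp
  then show "\<sigma> (x / y) = \<sigma> x / \<sigma> y"
    using assms galois_group_eq_0_iff[OF assms(1,2,4)] by (simp add: field_simps)
qed

section \<open>Linear forms dividing a product of linear forms\<close>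

fun linear_form :: "complex vec3 \<Rightarrow> complex poly poly" where
  "linear_form (a, b, c) = linear_poly a b c"

fun eval_form :: "complex vec3 \<Rightarrow> complex \<Rightarrow> complex \<Rightarrow> complex" where
  "eval_form (a, b, c) x y = a * x + b * y + c"

lemma poly_linear_form: "poly (poly (linear_form u) [:y:]) x = eval_form u x y"
  by (cases u) (simp add: linear_poly_def algebra_simps)

text \<open>
  Two different common zeros make all \<open>2 \<times> 2\<close> minors of the two vectors vanish.
\<close>

lemma proportional_if_two_common_zeros:
  assumes "nondegenerate u" "nondegenerate w"
    and "eval_form u x y = 0" "eval_form u x' y' = 0"
    and "eval_form w x y = 0" "eval_form w x' y' = 0" "(x, y) \<noteq> (x', y')"
  shows "\<exists>r. r \<noteq> 0 \<and> u = scale r w"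
proof -
  obtain a b c a' b' c' where uw: "u = (a, b, c)" "w = (a', b', c')" by (metis prod_cases3)
  note eqs = assms(3-6)[unfolded uw eval_form.simps]
  have ker: "a * (x - x') + b * (y - y') = 0" "a' * (x - x') + b' * (y - y') = 0"
    using eqs by algebra+
  then have "(a * b' - b * a') * (x - x') = 0" "(a * b' - b * a') * (y - y') = 0" by algebra+
  with assms(7) have ab: "a * b' = b * a'" by auto
  have "a * c' = c * a'" "b * c' = c * b'" using eqs ab by algebra+
  note minors = ab this
  show ?thesis
  proof (cases "b' = 0")
    case True
    with assms(1,2) minors have "a \<noteq> 0" "a' \<noteq> 0" "b = 0" by (auto simp: uw)
    with True minors show ?thesis
      by (intro exI[of _ "a / a'"]) (auto simp: uw field_simps)
  next
    case False
    with assms(1,2) minors have "b \<noteq> 0" by (auto simp: uw)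
    with False minors show ?thesis
      by (intro exI[of _ "b / b'"]) (auto simp: uw field_simps)
  qed
qed

text \<open>
  The form \<open>u\<close> vanishes at infinitely many points of a line. At each of them one of the finitely many
  other forms vanishes, so some form vanishes at two of the points and is a multiple of \<open>u\<close>.
\<close>

lemma linear_factor_proportional:
  assumes "finite M" "nondegenerate u" "\<And>m. m \<in> M \<Longrightarrow> nondegenerate (w m)"
    and dvd: "linear_form u dvd (\<Prod>m\<in>M. linear_form (w m))"
  shows "\<exists>m\<in>M. \<exists>r. r \<noteq> 0 \<and> u = scale r (w m)"
proof -
  obtain a b c where u: "u = (a, b, c)" by (cases u)
  obtain x0 y0 where "eval_form u x0 y0 = 0"
  proof (cases "b = 0")
    case True
    with assms(2) that[of "- c / a" 0] show ?thesis by (auto simp: u)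
  next
    case False
    with that[of 0 "- c / b"] show ?thesis by (simp add: u)
  qed
  define X where "X = (\<lambda>t::nat. x0 - of_nat t * b)"
  define Y where "Y = (\<lambda>t::nat. y0 + of_nat t * a)"
  have zero: "eval_form u (X t) (Y t) = 0" for t
    using \<open>eval_form u x0 y0 = 0\<close> by (simp add: u X_def Y_def algebra_simps)
  have "\<exists>m\<in>M. eval_form (w m) (X t) (Y t) = 0" for t
  proof -
    obtain q where "(\<Prod>m\<in>M. linear_form (w m)) = linear_form u * q" using dvd by (rule dvdE)
    then have "poly (poly (\<Prod>m\<in>M. linear_form (w m)) [:Y t:]) (X t) = 0"
      by (simp add: poly_linear_form zero)
    then have "(\<Prod>m\<in>M. eval_form (w m) (X t) (Y t)) = 0"
      by (simp add: poly_prod poly_linear_form)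
    then show ?thesis using assms(1) by simp
  qed
  then obtain h where h: "\<And>t. h t \<in> M" "\<And>t. eval_form (w (h t)) (X t) (Y t) = 0" by metis
  have "\<not> inj h"
    using finite_subset[OF image_subsetI assms(1), of UNIV h] h(1) finite_imageD[of h UNIV] by auto
  then obtain s t where "h s = h t" "s \<noteq> t" by (auto simp: inj_def)
  then have "(X s, Y s) \<noteq> (X t, Y t)" using assms(2) by (auto simp: u X_def Y_def)
  then have "\<exists>r. r \<noteq> 0 \<and> u = scale r (w (h s))"
    using assms(2,3) h zero \<open>h s = h t\<close>
    by (intro proportional_if_two_common_zeros[of u _ "X s" "Y s" "X t" "Y t"]) metis+
  then show ?thesis using h(1) by blast
qed

lemma map_poly_linear_form:
  assumes "\<sigma> 0 = 0"
  shows "map_poly (map_poly \<sigma>) (linear_form u) = linear_form (map_vec3 \<sigma> u)"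
proof -
  obtain a b c where u: "u = (a, b, c)" by (cases u)
  show ?thesis
    by (auto simp: u linear_poly_def poly_eq_iff coeff_map_poly coeff_pCons assms split: nat.splits)
qed

section \<open>Equations of an equiconfigurational arrangement\<close>

lemma coordinate_field_subset_Reals: "coordinate_field \<A> \<subseteq> \<real>"
  unfolding coordinate_field_def
  by (rule hull_minimal) (auto simp: is_subfield_def)

text \<open>
  The coordinate field is real, so the complex equation of a line has real coefficients; its
  linear part is not zero, because otherwise the zero set would be empty or the whole plane.
\<close>

lemma is_equation_over_Reals:
  assumes "is_line m" "K \<subseteq> \<real>" "is_equation_over K m p"
  shows "\<exists>u. nondegenerate u \<and> m = line_of u \<and> p = linear_form (map_vec3 of_real u) \<and>
           vec_in K (map_vec3 of_real u)"
proof -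
  obtain a' b' c' where K: "a' \<in> K" "b' \<in> K" "c' \<in> K" and p: "p = linear_poly a' b' c'"
    and m: "m = {(x, y). a' * complex_of_real x + b' * complex_of_real y + c' = 0}"
    using assms(3) unfolding is_equation_over_def by blast
  with assms(2) have "a' \<in> \<real>" "b' \<in> \<real>" "c' \<in> \<real>" by auto
  then obtain a b c where abc: "a' = of_real a" "b' = of_real b" "c' = of_real c"
    by (metis Reals_cases)
  have line: "m = line_of (a, b, c)"
    unfolding m abc line_of_def by (simp flip: of_real_mult of_real_add)
  have "nondegenerate (a, b, c)"
  proof (rule ccontr)
    assume "\<not> nondegenerate (a, b, c)"
    then have "m = {} \<or> m = UNIV" unfolding line by (auto simp: line_of_def)
    moreover have "aff_dim m = 1" using assms(1) by (simp add: is_line_def)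
    ultimately show False by auto
  qed
  with K p line show ?thesis by (intro exI[of _ "(a, b, c)"]) (simp add: abc)
qed

text \<open>
  Comparing linear factors of the invariant product, \<open>\<sigma>\<close> maps each line to some line, up to a scalar.
  The resulting map \<open>\<pi>\<close> of labels preserves and reflects concurrency because \<open>\<sigma>\<close> commutes with
  determinants and is injective on \<open>K\<close>; by rigidity of the incidence structure, it is the identity.
\<close>

lemma galois_fixes_lines_if_invariant:
  fixes v :: "label \<Rightarrow> complex vec3"
  assumes K: "is_subfield K" and \<sigma>: "\<sigma> \<in> galois_group K"
    and vK: "\<And>i. vec_in K (v i)" and nondeg: "\<And>i. nondegenerate (v i)"
    and conc: "\<And>i j k. det3 (v i) (v j) (v k) = 0 \<longleftrightarrow> concurrent i j k"
    and invar: "map_poly (map_poly \<sigma>) (\<Prod>i\<in>UNIV. linear_form (v i)) = (\<Prod>i\<in>UNIV. linear_form (v i))"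
  shows "\<exists>r. r \<noteq> 0 \<and> map_vec3 \<sigma> (v i) = scale r (v i)"
proof -
  let ?w = "\<lambda>i. map_vec3 \<sigma> (v i)"
  note hom = galois_group_ring_hom_on[OF K \<sigma>]
  have \<sigma>0: "\<sigma> x = 0 \<longleftrightarrow> x = 0" if "x \<in> K" for x
    using galois_group_eq_0_iff[OF K \<sigma> that] .
  have det: "det3 (?w i) (?w j) (?w k) = 0 \<longleftrightarrow> concurrent i j k" for i j k
  proof -
    have "det3 (v i) (v j) (v k) \<in> K"
      and "det3 (?w i) (?w j) (?w k) = \<sigma> (det3 (v i) (v j) (v k))"
      by (simp_all add: ring_hom_on_det3[OF hom] vK)
    then show ?thesis using \<sigma>0 conc by simp
  qed
  have prod: "(\<Prod>i\<in>UNIV. linear_form (?w i)) = (\<Prod>i\<in>UNIV. linear_form (v i))"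
  proof -
    have "linear_form (v i) \<in> {p. \<forall>n. coeff p n \<in> {q. \<forall>n. coeff q n \<in> K}}" for i
      using vK[of i] ring_hom_on_zero(1)[OF hom]
      by (cases "v i") (auto simp: linear_poly_def coeff_pCons split: nat.splits)
    then have "map_poly (map_poly \<sigma>) (\<Prod>i\<in>UNIV. linear_form (v i))
        = (\<Prod>i\<in>UNIV. map_poly (map_poly \<sigma>) (linear_form (v i)))"
      by (intro ring_hom_on_prod[OF ring_hom_on_map_poly[OF ring_hom_on_map_poly[OF hom]]])
    then show ?thesis
      using invar by (simp add: map_poly_linear_form ring_hom_on_zero(2)[OF hom])
  qed
  have "\<exists>j. \<exists>r. r \<noteq> 0 \<and> ?w i = scale r (v j)" for i
  proof -
    have nd: "nondegenerate (?w i)"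
      using nondeg[of i] vK[of i] \<sigma>0 by (cases "v i") auto
    have "linear_form (?w i) dvd (\<Prod>i\<in>UNIV. linear_form (v i))"
      unfolding prod[symmetric] by (intro dvd_prodI) simp_all
    from linear_factor_proportional[OF finite nd nondeg this] show ?thesis by simp
  qed
  then obtain \<pi> where "\<forall>i. \<exists>r. r \<noteq> 0 \<and> ?w i = scale r (v (\<pi> i))"
    using choice[of "\<lambda>i j. \<exists>r. r \<noteq> 0 \<and> ?w i = scale r (v j)"] by blast
  then obtain \<rho> where \<rho>: "\<And>i. \<rho> i \<noteq> 0" and w: "\<And>i. ?w i = scale (\<rho> i) (v (\<pi> i))"
    using choice[of "\<lambda>i r. r \<noteq> 0 \<and> ?w i = scale r (v (\<pi> i))"] by blast
  have \<pi>: "concurrent (\<pi> i) (\<pi> j) (\<pi> k) \<longleftrightarrow> concurrent i j k" for i j k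
    using det[of i j k] \<rho> by (simp add: w det3_scale conc)
  have "inj \<pi>"
  proof (rule injI)
    \<comment> \<open>Lines with the same image are concurrent with every third line.\<close>
    fix i j assume "\<pi> i = \<pi> j"
    then have "concurrent i j k" for k
      using \<pi>[of i j k] by (simp add: concurrent_def[of "\<pi> j"])
    then show "i = j" by (rule concurrent_all_imp_eq)
  qed
  then have "\<pi> i = i" using \<pi> by (rule concurrence_automorphism_trivial)
  with \<rho>[of i] w[of i] show ?thesis by auto
qed

lemma cross_ratio_scale:
  fixes v :: "label \<Rightarrow> 'a::field vec3"
  assumes "\<And>i. \<rho> i \<noteq> 0" "\<And>i. w i = scale (\<rho> i) (v i)"
  shows "cross_ratio w = cross_ratio v"
  using assms(1) by (simp add: cross_ratio_def assms(2) det3_scale)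

lemma galois_cross_ratio:
  fixes v :: "label \<Rightarrow> complex vec3"
  assumes K: "is_subfield K" and \<sigma>: "\<sigma> \<in> galois_group K"
    and vK: "\<And>i. vec_in K (v i)"
    and conc: "\<And>i j k. det3 (v i) (v j) (v k) = 0 \<longleftrightarrow> concurrent i j k"
  shows "cross_ratio v \<in> K" "\<sigma> (cross_ratio v) = cross_ratio (\<lambda>i. map_vec3 \<sigma> (v i))"
proof -
  note hom = galois_group_ring_hom_on[OF K \<sigma>]
  have detK: "det3 (v i) (v j) (v k) \<in> K"
    and det: "det3 (map_vec3 \<sigma> (v i)) (map_vec3 \<sigma> (v j)) (map_vec3 \<sigma> (v k)) = \<sigma> (det3 (v i) (v j) (v k))"
    for i j k by (simp_all add: ring_hom_on_det3[OF hom] vK)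
  have ne: "det3 (v AB) (v BI) (v CI) * det3 (v AB) (v AI) (v DI) \<noteq> 0"
    by (simp add: conc concurrent_def multiple_points_def)
  note mult = ring_hom_on_mult[OF hom detK detK]
  show "cross_ratio v \<in> K" "\<sigma> (cross_ratio v) = cross_ratio (\<lambda>i. map_vec3 \<sigma> (v i))"
    unfolding cross_ratio_def det mult(2)[symmetric]
    by (rule galois_group_divide[OF K \<sigma> mult(1) mult(1) ne])+
qed

theorem proposition2p2:
  fixes \<A>' :: "line set"
    and l :: "line \<Rightarrow> complex poly poly"
    and L :: "complex set"
  assumes "line_arrangement \<A>'"
    and "equiconfigurational arrC'_bar \<A>'"
    and "\<And>m. m \<in> \<A>' \<Longrightarrow> is_equation_over (coordinate_field \<A>') m (l m)"
    and "galois_over_Rats L"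
    and "coordinate_field \<A>' \<subseteq> L"
  shows "\<not> invariant_under (galois_group L) (\<Prod>m\<in>\<A>'. l m)"
proof
  assume invar: "invariant_under (galois_group L) (\<Prod>m\<in>\<A>'. l m)"
  have L: "is_subfield L" and fixed: "{x\<in>L. \<forall>\<sigma>\<in>galois_group L. \<sigma> x = x} = \<rat>"
    using assms(4) by (simp_all add: galois_over_Rats_def)
  let ?P = "\<lambda>i. line_of (pent_coeffs i)"
  obtain f where f: "bij_betw f (range ?P) \<A>'"
    and f_conc: "\<And>S. S \<subseteq> range ?P \<Longrightarrow> have_common_point S \<longleftrightarrow> have_common_point (f ` S)"
    using assms(2) unfolding equiconfigurational_def arrC'_bar_eq by blast
  define g where "g = (\<lambda>i. f (?P i))"
  have g: "bij_betw g UNIV \<A>'"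
    using bij_betw_trans[OF inj_on_imp_bij_betw[OF inj_pent_lines] f] by (simp add: g_def comp_def)
  then have gA: "g i \<in> \<A>'" for i by (auto simp: bij_betw_def)
  have "\<exists>u. nondegenerate u \<and> g i = line_of u \<and> l (g i) = linear_form (map_vec3 of_real u) \<and>
      vec_in (coordinate_field \<A>') (map_vec3 of_real u)" for i
    using assms(1) assms(3)[OF gA] gA coordinate_field_subset_Reals
    by (intro is_equation_over_Reals) (auto simp: line_arrangement_def)
  then obtain u where u: "\<And>i. nondegenerate (u i)" "\<And>i. g i = line_of (u i)"
      "\<And>i. l (g i) = linear_form (map_vec3 of_real (u i))"
      "\<And>i. vec_in (coordinate_field \<A>') (map_vec3 of_real (u i))"
    by metis
  define v where "v = (\<lambda>i. map_vec3 complex_of_real (u i))"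
  have conc: "det3 (v i) (v j) (v k) = 0 \<longleftrightarrow> concurrent i j k" for i j k
  proof -
    have "det3 (v i) (v j) (v k) = of_real (det3 (u i) (u j) (u k))"
      unfolding v_def by (cases "u i"; cases "u j"; cases "u k") simp
    then have "det3 (v i) (v j) (v k) = 0 \<longleftrightarrow> have_common_point (f ` {?P i, ?P j, ?P k})"
      by (simp add: u(1) flip: have_common_point_iff_det3 u(2)) (simp add: g_def)
    also have "\<dots> \<longleftrightarrow> have_common_point {?P i, ?P j, ?P k}"
      by (rule f_conc[symmetric]) auto
    also have "\<dots> \<longleftrightarrow> concurrent i j k"
      by (simp add: have_common_point_iff_det3 nondegenerate_pent_coeffs det3_pent_coeffs)
    finally show ?thesis .
  qed
  have vL: "vec_in L (v i)" for i using u(4)[of i] assms(5) by (cases "u i") (auto simp: v_def)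
  have v_nondeg: "nondegenerate (v i)" for i
    using u(1)[of i] by (cases "u i") (simp add: v_def)
  have prod: "(\<Prod>m\<in>\<A>'. l m) = (\<Prod>i\<in>UNIV. linear_form (v i))"
    unfolding prod.reindex_bij_betw[OF g, of l, symmetric] by (simp add: u(3) v_def)
  have "\<sigma> (cross_ratio v) = cross_ratio v" if \<sigma>: "\<sigma> \<in> galois_group L" for \<sigma>
  proof -
    have "\<exists>r. r \<noteq> 0 \<and> map_vec3 \<sigma> (v i) = scale r (v i)" for i
      using invar \<sigma> unfolding invariant_under_def prod
      by (intro galois_fixes_lines_if_invariant[OF L \<sigma> vL v_nondeg conc]) simp
    then obtain \<rho> where "\<And>i. \<rho> i \<noteq> 0" "\<And>i. map_vec3 \<sigma> (v i) = scale (\<rho> i) (v i)"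
      using choice[of "\<lambda>i r. r \<noteq> 0 \<and> map_vec3 \<sigma> (v i) = scale r (v i)"] by blast
    then show ?thesis
      using galois_cross_ratio(2)[OF L \<sigma> vL conc] cross_ratio_scale[of \<rho> "\<lambda>i. map_vec3 \<sigma> (v i)" v]
      by simp
  qed
  moreover have "cross_ratio v \<in> L"
  proof -
    have "id \<in> galois_group L" by (simp add: galois_group_def)
    then show ?thesis using galois_cross_ratio(1)[OF L _ vL conc] by blast
  qed
  ultimately have "cross_ratio v \<in> \<rat>" using fixed by blast
  with cross_ratio_irrational[OF conc] show False by blast
qed

end
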